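(* Let $\Gamma$ be a compact metric graph and let $(\Delta_\Gamma,\mathcal{D}(\Delta_\Gamma))$ be the edgewise Laplacian on $\mathbb{L}_2(\Gamma)$ coupled with vertex conditions that make it self-adjoint. Assume that it has compact resolvent and that there is $\rho>0$ such that $\rho-\Delta_\Gamma$ is positive. Let $\{\varphi_i\}_{i\in\mathbb{N}}\subset\mathcal{D}(\Delta_\Gamma)$ be an orthonormal basis of $\mathbb{L}_2(\Gamma)$ consisting of eigenfunctions, $\Delta_\Gamma\varphi_i=-\lambda_i\varphi_i$ with $\lim_{i\to\infty}\lambda_i=\infty$. Then the eigenfunctions are uniformly bounded: $$\sup_{i\in\mathbb{N}}\ \sup_{x\in\Gamma}|\varphi_i(x)|<\infty.$$
   Context: $\Gamma$ is a compact metric graph: it is obtained from a finite connected graph (loops and multiple edges allowed) by identifying every edge $e\in\mathcal{E}$ with an interval $[0,l_e]$, $0<l_e<\infty$, and gluing together the interval endpoints that correspond to the same vertex. Functions on an edge $e$ are identified with functions on $[0,l_e]$ (either orientation); $\mathbb{L}_2(\Gamma)=\bigoplus_e\mathbb{L}_2(e)$ (real-valued functions), $H^2(e)=H^2(0,l_e)$. The edgewise Laplacian is $\Delta_\Gamma u=u''$ on each edge, for $u$ in a domain $\mathcal{D}(\Delta_\Gamma)\subset\bigoplus_eH^2(e)$ determined by linear conditions on the boundary values of $u$ and $u'$ at the ends of the edges at the vertices (for instance, at each vertex, continuity together with a Kirchhoff condition "sum of the inward derivatives equals $0$", a Dirichlet condition $u(v)=0$, or a generalized Kirchhoff condition "sum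 of inward derivatives equals a constant times $u(v)$"). Eigenfunctions are taken in their representatives that are continuous on each closed edge, and the supremum over $x\in\Gamma$ is the supremum over all closed edges. An operator $A$ is positive here in the sense of $\langle Au,u\rangle>0$ for nonzero $u$ in its domain. *)

theory Defs
  imports "HOL-Analysis.Analysis" "Graph_Theory.Digraph" "Graph_Theory.Digraph_Component"
begin

section \<open>Compact metric graphs\<close>

text \<open>
  Loops and multiple edges are allowed.  The direction of an arc only fixes the identification
  of the edge \<open>e\<close> with \<open>{0..len e}\<close> (the tail at \<open>0\<close>, the head at \<open>len e\<close>); connectedness is
  that of the underlying undirected graph.  A function on the graph is a family of functions
  on the edges, whose values outside \<open>{0..len e}\<close> are irrelevant.
\<close>

locale compact_metric_graph = fin_digraph G
  for G :: "('v, 'e) pre_digraph" and len :: "'e \<Rightarrow> real" +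
  assumes connected_graph: "Digraph_Component.connected G"
    and len_pos: "e \<in> arcs G \<Longrightarrow> 0 < len e"

type_synonym 'e edgefun = "'e \<Rightarrow> real \<Rightarrow> real"

section \<open>Sobolev spaces on an interval\<close>

definition L2_interval :: "real \<Rightarrow> (real \<Rightarrow> real) set" where
  "L2_interval l = {f. f \<in> borel_measurable (lebesgue_on {0..l}) \<and>
     integrable (lebesgue_on {0..l}) (\<lambda>x. (f x)\<^sup>2)}"

text \<open>Test functions: \<open>C\<^sup>1\<close> with compact support in the open interval.\<close>

definition test_functions :: "real \<Rightarrow> (real \<Rightarrow> real) set" where
  "test_functions l = {\<phi>. \<phi> C1_differentiable_on UNIV \<and>
     (\<exists>K. compact K \<and> K \<subseteq> {0<..<l} \<and> (\<forall>x. x \<notin> K \<longrightarrow> \<phi> x = 0))}"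

definition is_weak_deriv :: "real \<Rightarrow> (real \<Rightarrow> real) \<Rightarrow> (real \<Rightarrow> real) \<Rightarrow> bool" where
  "is_weak_deriv l u g \<longleftrightarrow> (\<forall>\<phi>\<in>test_functions l.
     (LINT x|lebesgue_on {0..l}. u x * deriv \<phi> x) = - (LINT x|lebesgue_on {0..l}. g x * \<phi> x))"

definition H1_interval :: "real \<Rightarrow> (real \<Rightarrow> real) set" where
  "H1_interval l = {u \<in> L2_interval l. \<exists>g\<in>L2_interval l. is_weak_deriv l u g}"

text \<open>For \<open>u \<in> H1_interval l\<close> this is determined up to equality almost everywhere.\<close>

definition weak_deriv :: "real \<Rightarrow> (real \<Rightarrow> real) \<Rightarrow> (real \<Rightarrow> real)" where
  "weak_deriv l u = (SOME g. g \<in> L2_interval l \<and> is_weak_deriv l u g)"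

definition H2_interval :: "real \<Rightarrow> (real \<Rightarrow> real) set" where
  "H2_interval l = {u \<in> H1_interval l. weak_deriv l u \<in> H1_interval l}"

section \<open>The Hilbert space of square integrable functions on a metric graph\<close>

text \<open>
  The space is represented by functions; its elements are the classes modulo \<open>ae_eq\<close>.
\<close>

definition L2_graph :: "('v, 'e) pre_digraph \<Rightarrow> ('e \<Rightarrow> real) \<Rightarrow> 'e edgefun set" where
  "L2_graph G len = {u. \<forall>e\<in>arcs G. u e \<in> L2_interval (len e)}"

definition ae_eq :: "('v, 'e) pre_digraph \<Rightarrow> ('e \<Rightarrow> real) \<Rightarrow> 'e edgefun \<Rightarrow> 'e edgefun \<Rightarrow> bool" where
  "ae_eq G len u v \<longleftrightarrow> (\<forall>e\<in>arcs G. AE x in lebesgue_on {0..len e}. u e x = v e x)"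

definition L2_inner :: "('v, 'e) pre_digraph \<Rightarrow> ('e \<Rightarrow> real) \<Rightarrow> 'e edgefun \<Rightarrow> 'e edgefun \<Rightarrow> real" where
  "L2_inner G len u v = (\<Sum>e\<in>arcs G. LINT x|lebesgue_on {0..len e}. u e x * v e x)"

definition L2_norm :: "('v, 'e) pre_digraph \<Rightarrow> ('e \<Rightarrow> real) \<Rightarrow> 'e edgefun \<Rightarrow> real" where
  "L2_norm G len u = sqrt (L2_inner G len u u)"

definition L2_dense :: "('v, 'e) pre_digraph \<Rightarrow> ('e \<Rightarrow> real) \<Rightarrow> 'e edgefun set \<Rightarrow> bool" where
  "L2_dense G len D \<longleftrightarrow> D \<subseteq> L2_graph G len \<and>
     (\<forall>f\<in>L2_graph G len. \<forall>\<epsilon>>0. \<exists>u\<in>D. L2_norm G len (\<lambda>e x. f e x - u e x) < \<epsilon>)"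

definition orthonormal_basis ::
  "('v, 'e) pre_digraph \<Rightarrow> ('e \<Rightarrow> real) \<Rightarrow> (nat \<Rightarrow> 'e edgefun) \<Rightarrow> bool" where
  "orthonormal_basis G len \<phi> \<longleftrightarrow>
     (\<forall>i. \<phi> i \<in> L2_graph G len) \<and>
     (\<forall>i j. L2_inner G len (\<phi> i) (\<phi> j) = (if i = j then 1 else 0)) \<and>
     L2_dense G len {u. \<exists>N c. u = (\<lambda>e x. \<Sum>i<N. c i * \<phi> i e x)}"

section \<open>Unbounded operators\<close>

text \<open>
  An operator is given by its domain \<open>D\<close> (a set of representatives) and its action \<open>A\<close>.
  Self-adjointness says that \<open>D\<close> is dense and that the adjoint, whose graph is the set of all
  \<open>(v, w)\<close> with \<open>\<langle>A u, v\<rangle> = \<langle>u, w\<rangle>\<close> for every \<open>u \<in> D\<close>, coincides with the operator itself.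
\<close>

definition self_adjoint :: "('v, 'e) pre_digraph \<Rightarrow> ('e \<Rightarrow> real) \<Rightarrow>
    'e edgefun set \<Rightarrow> ('e edgefun \<Rightarrow> 'e edgefun) \<Rightarrow> bool" where
  "self_adjoint G len D A \<longleftrightarrow> L2_dense G len D \<and>
     (\<forall>v\<in>L2_graph G len. \<forall>w\<in>L2_graph G len.
        (\<forall>u\<in>D. L2_inner G len (A u) v = L2_inner G len u w) \<longleftrightarrow>
        (\<exists>v'\<in>D. ae_eq G len v' v \<and> ae_eq G len (A v') w))"

definition positive_op :: "('v, 'e) pre_digraph \<Rightarrow> ('e \<Rightarrow> real) \<Rightarrow>
    'e edgefun set \<Rightarrow> ('e edgefun \<Rightarrow> 'e edgefun) \<Rightarrow> bool" where
  "positive_op G len D A \<longleftrightarrow>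
     (\<forall>u\<in>D. \<not> ae_eq G len u (\<lambda>e x. 0) \<longrightarrow> 0 < L2_inner G len (A u) u)"

definition shifted :: "real \<Rightarrow> ('e edgefun \<Rightarrow> 'e edgefun) \<Rightarrow> 'e edgefun \<Rightarrow> 'e edgefun" where
  "shifted z A u = (\<lambda>e x. z * u e x - A u e x)"

text \<open>\<open>R\<close> is a bounded everywhere defined two-sided inverse of \<open>z - A\<close>.\<close>

definition is_resolvent :: "('v, 'e) pre_digraph \<Rightarrow> ('e \<Rightarrow> real) \<Rightarrow>
    'e edgefun set \<Rightarrow> ('e edgefun \<Rightarrow> 'e edgefun) \<Rightarrow> real \<Rightarrow> ('e edgefun \<Rightarrow> 'e edgefun) \<Rightarrow> bool" where
  "is_resolvent G len D A z R \<longleftrightarrow>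
     (\<forall>f\<in>L2_graph G len. R f \<in> D \<and> ae_eq G len (shifted z A (R f)) f) \<and>
     (\<forall>u\<in>D. ae_eq G len (R (shifted z A u)) u) \<and>
     (\<exists>K. \<forall>f\<in>L2_graph G len. L2_norm G len (R f) \<le> K * L2_norm G len f)"

definition compact_op :: "('v, 'e) pre_digraph \<Rightarrow> ('e \<Rightarrow> real) \<Rightarrow>
    ('e edgefun \<Rightarrow> 'e edgefun) \<Rightarrow> bool" where
  "compact_op G len R \<longleftrightarrow>
     (\<forall>f :: nat \<Rightarrow> 'e edgefun.
        (\<forall>n. f n \<in> L2_graph G len) \<and> (\<exists>K. \<forall>n. L2_norm G len (f n) \<le> K) \<longrightarrow>
        (\<exists>r g. strict_mono (r :: nat \<Rightarrow> nat) \<and> g \<in> L2_graph G len \<and>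
           (\<lambda>n. L2_norm G len (\<lambda>e x. R (f (r n)) e x - g e x)) \<longlonglongrightarrow> 0))"

definition compact_resolvent :: "('v, 'e) pre_digraph \<Rightarrow> ('e \<Rightarrow> real) \<Rightarrow>
    'e edgefun set \<Rightarrow> ('e edgefun \<Rightarrow> 'e edgefun) \<Rightarrow> bool" where
  "compact_resolvent G len D A \<longleftrightarrow> (\<exists>z R. is_resolvent G len D A z R \<and> compact_op G len R)"

section \<open>The edgewise Laplacian with vertex conditions\<close>

datatype side = At_Tail | At_Head

definition edge_ends :: "('v, 'e) pre_digraph \<Rightarrow> ('e \<times> side) set" where
  "edge_ends G = arcs G \<times> {At_Tail, At_Head}"

fun end_vertex :: "('v, 'e) pre_digraph \<Rightarrow> 'e \<times> side \<Rightarrow> 'v" where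
  "end_vertex G (e, At_Tail) = tail G e"
| "end_vertex G (e, At_Head) = head G e"

fun end_value :: "('e \<Rightarrow> real) \<Rightarrow> 'e edgefun \<Rightarrow> 'e \<times> side \<Rightarrow> real" where
  "end_value len u (e, At_Tail) = u e 0"
| "end_value len u (e, At_Head) = u e (len e)"

text \<open>The derivative pointing from the vertex into the edge.\<close>

fun end_deriv :: "('e \<Rightarrow> real) \<Rightarrow> 'e edgefun \<Rightarrow> 'e \<times> side \<Rightarrow> real" where
  "end_deriv len u (e, At_Tail) = vector_derivative (u e) (at 0 within {0..len e})"
| "end_deriv len u (e, At_Head) = - vector_derivative (u e) (at (len e) within {0..len e})"

text \<open>
  A homogeneous linear condition on the boundary values is given by a pair \<open>(a, b)\<close> of
  coefficient families, for the values and for the derivatives.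
\<close>

type_synonym 'e boundary_condition = "('e \<times> side \<Rightarrow> real) \<times> ('e \<times> side \<Rightarrow> real)"

definition satisfies_condition :: "('v, 'e) pre_digraph \<Rightarrow> ('e \<Rightarrow> real) \<Rightarrow>
    'e edgefun \<Rightarrow> 'e boundary_condition \<Rightarrow> bool" where
  "satisfies_condition G len u c \<longleftrightarrow>
     (\<Sum>h\<in>edge_ends G. fst c h * end_value len u h + snd c h * end_deriv len u h) = 0"

text \<open>
  Conditions local to a vertex (continuity, Kirchhoff, Dirichlet, ...) are those whose
  coefficients vanish off the ends at that vertex.
\<close>

lemma satisfies_condition_local:
  assumes "fin_digraph G"
    and "\<And>h. end_vertex G h \<noteq> v \<Longrightarrow> a h = 0 \<and> b h = 0"
  shows "satisfies_condition G len u (a, b) \<longleftrightarrow>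
    (\<Sum>h | h \<in> edge_ends G \<and> end_vertex G h = v.
       a h * end_value len u h + b h * end_deriv len u h) = 0"
proof -
  have fin: "finite (edge_ends G)"
    using fin_digraph.finite_arcs[OF assms(1)] by (simp add: edge_ends_def)
  have "(\<Sum>h\<in>edge_ends G. a h * end_value len u h + b h * end_deriv len u h) =
    (\<Sum>h | h \<in> edge_ends G \<and> end_vertex G h = v.
       a h * end_value len u h + b h * end_deriv len u h)"
    by (rule sum.mono_neutral_right) (use fin assms(2) in auto)
  then show ?thesis by (simp add: satisfies_condition_def)
qed

text \<open>
  The elements of the domain are continuous on each closed edge, so that they are the
  continuous representatives (automatically \<open>C\<^sup>1\<close> up to the ends) of their classes.
\<close>

definition laplacian_domain :: "('v, 'e) pre_digraph \<Rightarrow> ('e \<Rightarrow> real) \<Rightarrow>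
    'e boundary_condition set \<Rightarrow> 'e edgefun set" where
  "laplacian_domain G len C = {u.
     (\<forall>e\<in>arcs G. u e \<in> H2_interval (len e) \<and> continuous_on {0..len e} (u e)) \<and>
     (\<forall>c\<in>C. satisfies_condition G len u c)}"

definition laplacian :: "('e \<Rightarrow> real) \<Rightarrow> 'e edgefun \<Rightarrow> 'e edgefun" where
  "laplacian len u = (\<lambda>e. weak_deriv (len e) (weak_deriv (len e) (u e)))"

end

theory Submission
  imports Defs
begin

text \<open>
  On an edge of length \<open>l\<close> the eigenvalue equation \<open>u'' = - lam u\<close> holds weakly; if \<open>V'' = u\<close>, then
  \<open>w = u + lam V\<close> has vanishing weak second derivative, hence is affine, and the equation holds
  classically.  So the energy \<open>K = u'\<^sup>2 + lam u\<^sup>2\<close> is constant, and \<open>lam u\<^sup>2 \<le> K\<close>.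
  Since \<open>(u u')' = K - 2 lam u\<^sup>2\<close> and \<open>\<bar>u u'\<bar> \<le> K / (2 sqrt lam)\<close>, integrating over
  \<open>[l/4, 3l/4]\<close> bounds \<open>K\<close> by a multiple of \<open>lam \<integral> u\<^sup>2 \<le> lam\<close> as soon as \<open>sqrt lam \<ge> 8 / l\<close>.
  This covers all but finitely many eigenfunctions, and the others are bounded by continuity.
\<close>

section \<open>Primitives, test functions and integrals on the line\<close>

lemma integral_eq_zero_on:
  fixes f :: "'a::euclidean_space \<Rightarrow> real"
  assumes "\<And>x. x \<in> S \<Longrightarrow> f x = 0"
  shows "integral S f = 0"
  using Henstock_Kurzweil_Integration.integral_cong[of S f "\<lambda>_. 0"] assms by simp

text \<open>Test functions live on the whole line, so their two-sided derivative is needed also for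
  \<open>x \<le> 0\<close>, where \<open>{0..x}\<close> is empty or a point. Left of
  \<open>d\<close> the primitive is locally 0; from \<open>d\<close> on, \<open>x\<close> is
  interior to \<open>{0..x+1}\<close> and the fundamental theorem applies.\<close>

lemma has_real_derivative_integral_from_0:
  fixes f :: "real \<Rightarrow> real"
  assumes cont: "continuous_on UNIV f" and d: "d > 0" and zero: "\<And>x. x \<le> d \<Longrightarrow> f x = 0"
  shows "((\<lambda>x. integral {0..x} f) has_real_derivative f x) (at x)"
proof (cases "x < d")
  case True
  have z: "integral {0..y} f = 0" if "y < d" for y
    using that zero by (intro integral_eq_zero_on) auto
  have "((\<lambda>x. 0) has_real_derivative f x) (at x)"
    using zero[of x] True by simp
  then show ?thesis
    by (rule has_field_derivative_transform_within_open[where S = "{..<d}"]) (use True z in auto)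
next
  case False
  have "((\<lambda>x. integral {0..x} f) has_real_derivative f x) (at x within {0..x+1})"
    by (rule integral_has_real_derivative)
       (use False d cont in \<open>auto intro: continuous_on_subset\<close>)
  moreover have "at x within {0..x+1} = at x"
    using False d by (intro at_within_interior) auto
  ultimately show ?thesis by simp
qed

lemma C1_differentiable_on_UNIV_I:
  fixes f :: "real \<Rightarrow> real"
  assumes "\<And>x. (f has_real_derivative f' x) (at x)" and "continuous_on UNIV f'"
  shows "f C1_differentiable_on UNIV"
  unfolding C1_differentiable_on_def
  using assms has_real_derivative_iff_has_vector_derivative by blast

lemma deriv_eqI:
  assumes "\<And>x. (f has_real_derivative f' x) (at x)"
  shows "deriv f = f'"
  using assms DERIV_imp_deriv by blast

lemma test_functionI:
  fixes f :: "real \<Rightarrow> real"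
  assumes "\<And>x. (f has_real_derivative f' x) (at x)" "continuous_on UNIV f'"
    and "0 < d" "d \<le> b" "b < l" "\<And>x. x \<le> d \<Longrightarrow> f x = 0" "\<And>x. b \<le> x \<Longrightarrow> f x = 0"
  shows "f \<in> test_functions l"
proof -
  have "f x = 0" if "x \<notin> {d..b}" for x
    using assms(6,7)[of x] that by force
  then show ?thesis
    unfolding test_functions_def
    using C1_differentiable_on_UNIV_I[OF assms(1,2)] assms(3-5)
    by (auto intro!: exI[of _ "{d..b}"])
qed

lemma integral_FTC_real:
  fixes F :: "real \<Rightarrow> real"
  assumes "a \<le> b" "\<And>x. x \<in> {a..b} \<Longrightarrow> (F has_real_derivative f x) (at x within {a..b})"
  shows "(f has_integral F b - F a) {a..b}"
  using assms by (intro fundamental_theorem_of_calculus)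
    (auto simp: has_real_derivative_iff_has_vector_derivative)

lemma weak_deriv_H1:
  assumes "u \<in> H1_interval l"
  shows "weak_deriv l u \<in> L2_interval l" "is_weak_deriv l u (weak_deriv l u)"
proof -
  have "\<exists>g. g \<in> L2_interval l \<and> is_weak_deriv l u g"
    using assms by (auto simp: H1_interval_def)
  from someI_ex[OF this] show "weak_deriv l u \<in> L2_interval l" "is_weak_deriv l u (weak_deriv l u)"
    by (auto simp: weak_deriv_def)
qed

text \<open>Weak derivatives are defined by Lebesgue integrals, while the calculus below uses the
  gauge integral; this passes between the two.\<close>

lemma LINT_interval_eq_integral:
  fixes f :: "real \<Rightarrow> real"
  assumes "continuous_on {a..b} f"
  shows "(LINT x|lebesgue_on {a..b}. f x) = integral {a..b} f"
  by (rule lebesgue_integral_eq_integral) (use assms in \<open>auto intro: continuous_imp_integrable_real\<close>)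

section \<open>From the weak to the classical equation on one edge\<close>

locale edge_eigenfunction =
  fixes l lam :: real and u :: "real \<Rightarrow> real"
  assumes l_pos: "l > 0" and H2: "u \<in> H2_interval l" and cont: "continuous_on {0..l} u"
    and eigen: "AE x in lebesgue_on {0..l}. weak_deriv l (weak_deriv l u) x = - lam * u x"
begin

definition V1 where "V1 x = integral {0..x} u"
definition V where "V x = integral {0..x} V1"
definition w where "w x = u x + lam * V x"

lemma V1_deriv: "x \<in> {0..l} \<Longrightarrow> (V1 has_real_derivative u x) (at x within {0..l})"
  unfolding V1_def by (rule integral_has_real_derivative[OF cont])

lemma V1_cont: "continuous_on {0..l} V1"
  using V1_deriv by (rule DERIV_continuous_on)

lemma V_deriv: "x \<in> {0..l} \<Longrightarrow> (V has_real_derivative V1 x) (at x within {0..l})"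
  unfolding V_def by (rule integral_has_real_derivative[OF V1_cont])

lemma V_cont: "continuous_on {0..l} V"
  using V_deriv by (rule DERIV_continuous_on)

lemma w_cont: "continuous_on {0..l} w"
  unfolding w_def by (intro continuous_intros cont V_cont)

text \<open>With \<open>\<psi> = p''\<close> and \<open>p\<close> compactly supported in the open
  edge, using the weak derivatives of \<open>u\<close> twice gives
  \<open>\<integral> u \<psi> = - lam \<integral> u p\<close>, and ordinary integration by parts
  gives \<open>\<integral> V \<psi> = \<integral> u p\<close>. Adding \<open>lam\<close> times the
  second to the first yields the claim.\<close>

lemma integral_w_orthogonal:
  assumes \<psi>: "continuous_on UNIV \<psi>" and d: "0 < d" "d \<le> b" "b < l"
    and zero: "\<And>x. x \<le> d \<Longrightarrow> \<psi> x = 0" "\<And>x. b \<le> x \<Longrightarrow> \<psi> x = 0"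
    and m0: "integral {0..l} \<psi> = 0" and m1: "integral {0..l} (\<lambda>x. x * \<psi> x) = 0"
  shows "integral {0..l} (\<lambda>x. w x * \<psi> x) = 0"
proof -
  \<comment> \<open>By the moment conditions the twofold primitive \<open>p\<close> of \<open>\<psi>\<close> has compact support.\<close>
  define p1 where "p1 = (\<lambda>x. integral {0..x} \<psi>)"
  define p where "p = (\<lambda>x. integral {0..x} p1)"
  \<comment> \<open>Past \<open>b\<close> the integral from 0 no longer changes, so it equals its
    value at \<open>l\<close>.\<close>
  have stable: "integral {0..x} f = 0"
    if "continuous_on UNIV f" "\<And>x. b \<le> x \<Longrightarrow> f x = 0" "integral {0..l} f = 0" "b \<le> x"
    for f :: "real \<Rightarrow> real" and x
  proof -
    have "integral {0..y} f = integral {0..b} f" if "b \<le> y" for y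
    proof -
      have "integral {0..b} f + integral {b..y} f = integral {0..y} f"
        by (rule Henstock_Kurzweil_Integration.integral_combine)
          (use d \<open>b \<le> y\<close> \<open>continuous_on UNIV f\<close> in \<open>auto intro!: integrable_continuous_real intro: continuous_on_subset\<close>)
      moreover have "integral {b..y} f = 0"
        by (rule integral_eq_zero_on) (use \<open>\<And>x. b \<le> x \<Longrightarrow> f x = 0\<close> in auto)
      ultimately show ?thesis by simp
    qed
    from this[of l] this[of x] show ?thesis using that d by simp
  qed
  have p1': "(p1 has_real_derivative \<psi> x) (at x)" for x
    unfolding p1_def by (rule has_real_derivative_integral_from_0[OF \<psi> d(1) zero(1)])
  have p1c: "continuous_on UNIV p1"
    using p1' DERIV_isCont continuous_at_imp_continuous_on by blast
  have p10: "p1 x = 0" if "x \<le> d" for x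
    unfolding p1_def using that zero by (intro integral_eq_zero_on) auto
  have p1b: "p1 x = 0" if "b \<le> x" for x
    unfolding p1_def using stable[OF \<psi> zero(2) m0 that] .
  have p': "(p has_real_derivative p1 x) (at x)" for x
    unfolding p_def by (rule has_real_derivative_integral_from_0[OF p1c d(1) p10])
  have pc: "continuous_on UNIV p"
    using p' DERIV_isCont continuous_at_imp_continuous_on by blast
  have p0: "p x = 0" if "x \<le> d" for x
    unfolding p_def using that p10 by (intro integral_eq_zero_on) auto
  have c: "continuous_on {0..l} \<psi>" "continuous_on {0..l} p1" "continuous_on {0..l} p"
    using \<psi> p1c pc continuous_on_subset by blast+
  \<comment> \<open>Integrating \<open>(x p1)'\<close> turns the vanishing first moment of
    \<open>\<psi>\<close> into \<open>\<integral> p1 = 0\<close>, which makes \<open>p\<close>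
    vanish beyond \<open>b\<close>.\<close>
  have "((\<lambda>x. p1 x + x * \<psi> x) has_integral l * p1 l - 0 * p1 0) {0..l}"
    by (rule integral_FTC_real) (use l_pos in \<open>auto intro!: derivative_eq_intros DERIV_subset[OF p1']\<close>)
  from integral_unique[OF this] have "integral {0..l} (\<lambda>x. p1 x + x * \<psi> x) = 0"
    using p1b[of l] d by simp
  moreover have "integral {0..l} (\<lambda>x. p1 x + x * \<psi> x) = integral {0..l} p1 + integral {0..l} (\<lambda>x. x * \<psi> x)"
    by (rule Henstock_Kurzweil_Integration.integral_add) (auto intro!: integrable_continuous_real continuous_intros c)
  ultimately have "integral {0..l} p1 = 0" using m1 by simp
  then have pb: "p x = 0" if "b \<le> x" for x
    unfolding p_def using stable[OF p1c p1b _ that] by simp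
  have t1: "p1 \<in> test_functions l"
    by (rule test_functionI[OF p1' \<psi> d p10 p1b])
  have t: "p \<in> test_functions l"
    by (rule test_functionI[OF p' p1c d p0 pb])
  let ?g = "weak_deriv l u" and ?L = "lebesgue_on {0..l}"
  have uH: "u \<in> H1_interval l" and gH: "?g \<in> H1_interval l"
    using H2 by (auto simp: H2_interval_def)
  have "(LINT x|?L. u x * \<psi> x) = - (LINT x|?L. ?g x * p1 x)"
    using weak_deriv_H1(2)[OF uH, unfolded is_weak_deriv_def, rule_format, OF t1]
    by (simp add: deriv_eqI[OF p1'])
  also have "(LINT x|?L. ?g x * p1 x) = - (LINT x|?L. weak_deriv l ?g x * p x)"
    using weak_deriv_H1(2)[OF gH, unfolded is_weak_deriv_def, rule_format, OF t]
    by (simp add: deriv_eqI[OF p'])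
  also have "(LINT x|?L. weak_deriv l ?g x * p x) = (LINT x|?L. - lam * (u x * p x))"
  proof (rule integral_cong_AE)
    have pm: "p \<in> borel_measurable ?L" and um: "u \<in> borel_measurable ?L"
      using c cont by (auto intro: continuous_imp_measurable_on_sets_lebesgue)
    show "(\<lambda>x. weak_deriv l ?g x * p x) \<in> borel_measurable ?L"
      using weak_deriv_H1(1)[OF gH] pm by (auto simp: L2_interval_def)
    show "(\<lambda>x. - lam * (u x * p x)) \<in> borel_measurable ?L"
      using um pm by auto
    show "AE x in ?L. weak_deriv l ?g x * p x = - lam * (u x * p x)"
      using eigen by eventually_elim simp
  qed
  also have "\<dots> = - lam * (LINT x|?L. u x * p x)" by simp
  finally have A: "integral {0..l} (\<lambda>x. u x * \<psi> x) = - lam * integral {0..l} (\<lambda>x. u x * p x)"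
    by (simp add: LINT_interval_eq_integral cont c continuous_on_mult)
  \<comment> \<open>The integrand is the derivative of \<open>V1 p - V p1\<close>, as the terms
    \<open>V1 p1\<close> cancel; \<open>p\<close> and \<open>p1\<close> vanish at both ends.\<close>
  have "((\<lambda>x. u x * p x - V x * \<psi> x) has_integral
      (V1 l * p l - V l * p1 l) - (V1 0 * p 0 - V 0 * p1 0)) {0..l}"
    by (rule integral_FTC_real)
      (use l_pos in \<open>auto intro!: derivative_eq_intros V1_deriv V_deriv DERIV_subset[OF p'] DERIV_subset[OF p1']\<close>)
  from integral_unique[OF this] have "integral {0..l} (\<lambda>x. u x * p x - V x * \<psi> x) = 0"
    using p0[of 0] pb[of l] p10[of 0] p1b[of l] d by simp
  moreover have "integral {0..l} (\<lambda>x. u x * p x - V x * \<psi> x)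
      = integral {0..l} (\<lambda>x. u x * p x) - integral {0..l} (\<lambda>x. V x * \<psi> x)"
    by (rule Henstock_Kurzweil_Integration.integral_diff)
       (auto intro!: integrable_continuous_real continuous_intros c cont V_cont)
  moreover have "integral {0..l} (\<lambda>x. w x * \<psi> x)
      = integral {0..l} (\<lambda>x. u x * \<psi> x + lam * (V x * \<psi> x))"
    by (simp add: w_def algebra_simps)
  moreover have "\<dots> = integral {0..l} (\<lambda>x. u x * \<psi> x) + integral {0..l} (\<lambda>x. lam * (V x * \<psi> x))"
    by (rule Henstock_Kurzweil_Integration.integral_add)
       (auto intro!: integrable_continuous_real continuous_intros c cont V_cont)
  ultimately show ?thesis using A by simp
qed

text \<open>An argument of du Bois-Reymond type: the residual \<open>r\<close> of a weighted
  projection of \<open>w\<close> to the affine functions is orthogonal to these by construction and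
  to \<open>w\<close> by \<open>integral_w_orthogonal\<close>, hence to itself. The margin
  \<open>d\<close> keeps the support of the weight inside the open edge.\<close>

lemma w_affine:
  assumes d: "0 < d" "d < l / 2"
  obtains \<alpha> \<beta> where "\<And>x. d < x \<Longrightarrow> x < l - d \<Longrightarrow> w x = \<alpha> + \<beta> * x"
proof -
  \<comment> \<open>A parabola cut off at 0: continuous, and positive exactly between
    \<open>d\<close> and \<open>l - d\<close>.\<close>
  define \<eta> where "\<eta> = (\<lambda>x::real. max 0 ((x - d) * (l - d - x)))"
  have \<eta>c: "continuous_on S \<eta>" for S
    unfolding \<eta>_def by (intro continuous_intros)
  have \<eta>0: "\<eta> x \<ge> 0" for x by (simp add: \<eta>_def)
  have \<eta>pos: "\<eta> x > 0" if "d < x" "x < l - d" for x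
    using that by (simp add: \<eta>_def)
  have \<eta>out: "\<eta> x = 0" if "x \<le> d \<or> l - d \<le> x" for x
  proof -
    have "(x - d) * (l - d - x) \<le> 0"
      using that d by (auto intro: mult_nonpos_nonneg mult_nonneg_nonpos)
    then show ?thesis by (simp add: \<eta>_def)
  qed
  have vanish: "f x = 0"
    if "continuous_on {0..l} f" "integral {0..l} (\<lambda>x. \<eta> x * (f x)\<^sup>2) = 0" "d < x" "x < l - d"
    for f :: "real \<Rightarrow> real" and x
  proof -
    have c: "continuous_on {0..l} (\<lambda>x. \<eta> x * (f x)\<^sup>2)"
      by (intro continuous_intros \<eta>c that)
    have "((\<lambda>x. \<eta> x * (f x)\<^sup>2) has_integral 0) (cbox 0 l)"
      using integrable_integral[OF integrable_continuous_real[OF c]] that(2) by simp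
    then have "\<eta> x * (f x)\<^sup>2 = 0"
      using c d that \<eta>0 by (intro has_integral_0_cbox_imp_0[of 0 l "\<lambda>x. \<eta> x * (f x)\<^sup>2"]) auto
    then show ?thesis using \<eta>pos[of x] that by simp
  qed
  define I where "I = (\<lambda>f. integral {0..l} (\<lambda>x. \<eta> x * f x))"
  have I_int: "(\<lambda>x. \<eta> x * f x) integrable_on {0..l}" if "continuous_on {0..l} f" for f :: "real \<Rightarrow> real"
    by (intro integrable_continuous_real continuous_intros \<eta>c that)
  have I_add: "I (\<lambda>x. f x + g x) = I f + I g"
    if "continuous_on {0..l} f" "continuous_on {0..l} g" for f g :: "real \<Rightarrow> real"
    unfolding I_def distrib_left
    by (rule Henstock_Kurzweil_Integration.integral_add[OF I_int[OF that(1)] I_int[OF that(2)]])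
  have I_mult: "I (\<lambda>x. c * f x) = c * I f" for c and f :: "real \<Rightarrow> real"
    unfolding I_def by (subst mult.left_commute) simp
  have I_sq: "I (\<lambda>x. (f x)\<^sup>2) \<noteq> 0" if "continuous_on {0..l} f" "d < x" "x < l - d" "f x \<noteq> 0"
    for f :: "real \<Rightarrow> real" and x
    using vanish[OF that(1) _ that(2,3)] that(4) by (auto simp: I_def)
  define m where "m = I (\<lambda>x. 1)"
  \<comment> \<open>The weighted mean, which makes 1 and \<open>x - x0\<close> orthogonal for the
    weight \<open>\<eta>\<close>, so that the two projection coefficients decouple.\<close>
  define x0 where "x0 = I (\<lambda>x. x) / m"
  define q where "q = I (\<lambda>x. (x - x0)\<^sup>2)"
  have m: "m \<noteq> 0"
    using I_sq[of "\<lambda>x. 1" "l/2"] d by (simp add: m_def)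
  have c: "continuous_on {0..l} (\<lambda>x. x - x0)"
    by (intro continuous_intros)
  \<comment> \<open>Some point between \<open>d\<close> and \<open>l - d\<close> must differ from
    \<open>x0\<close>: the midpoint serves unless it is \<open>x0\<close> itself.\<close>
  have q: "q \<noteq> 0"
  proof (cases "x0 = l/2")
    case True
    then show ?thesis using I_sq[OF c, of "(d + l/2)/2"] d by (auto simp: q_def)
  next
    case False
    then show ?thesis using I_sq[OF c, of "l/2"] d by (auto simp: q_def)
  qed
  \<comment> \<open>\<open>a + b (x - x0)\<close> is the projection of \<open>w\<close> to the affine functions for the weight \<open>\<eta>\<close>, so
    that \<open>\<eta> r\<close> is an admissible \<open>\<psi>\<close> in \<open>integral_w_orthogonal\<close>.\<close>
  define a where "a = I w / m"
  define b where "b = I (\<lambda>x. (x - x0) * w x) / q"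
  define r where "r = (\<lambda>x. w x + ((- a) + (- b) * (x - x0)))"
  have rc: "continuous_on {0..l} r"
    unfolding r_def by (intro continuous_intros w_cont)
  have Ix: "I (\<lambda>x. x - x0) = 0"
    using I_add[of "\<lambda>x. x" "\<lambda>x. (-x0) * 1"] I_mult[of "-x0" "\<lambda>x. 1"] m
    by (simp add: continuous_intros x0_def m_def[symmetric])
  have Ic: "I (\<lambda>x. c) = c * m" for c
    using I_mult[of c "\<lambda>x. 1"] by (simp add: m_def)
  have Ir: "I r = 0"
  proof -
    have "I r = I w + I (\<lambda>x. (- a) + (- b) * (x - x0))"
      unfolding r_def by (rule I_add) (intro continuous_intros w_cont)+
    also have "I (\<lambda>x. (- a) + (- b) * (x - x0)) = I (\<lambda>x. - a) + I (\<lambda>x. (- b) * (x - x0))"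
      by (rule I_add) (intro continuous_intros)+
    finally show ?thesis using m unfolding I_mult Ix Ic a_def by simp
  qed
  have Irx0: "I (\<lambda>x. (x - x0) * r x) = 0"
  proof -
    have "(\<lambda>x. (x - x0) * r x) = (\<lambda>x. (x - x0) * w x + ((- a) * (x - x0) + (- b) * (x - x0)\<^sup>2))"
      by (auto simp: r_def algebra_simps power2_eq_square)
    then have "I (\<lambda>x. (x - x0) * r x) = I (\<lambda>x. (x - x0) * w x + ((- a) * (x - x0) + (- b) * (x - x0)\<^sup>2))"
      by simp
    also have "\<dots> = I (\<lambda>x. (x - x0) * w x) + I (\<lambda>x. (- a) * (x - x0) + (- b) * (x - x0)\<^sup>2)"
      by (rule I_add) (intro continuous_intros w_cont)+
    also have "I (\<lambda>x. (- a) * (x - x0) + (- b) * (x - x0)\<^sup>2) = I (\<lambda>x. (- a) * (x - x0)) + I (\<lambda>x. (- b) * (x - x0)\<^sup>2)"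
      by (rule I_add) (intro continuous_intros)+
    finally show ?thesis using q unfolding I_mult Ix b_def q_def[symmetric] by simp
  qed
  have Irx: "I (\<lambda>x. x * r x) = 0"
  proof -
    have "(\<lambda>x. x * r x) = (\<lambda>x. (x - x0) * r x + x0 * r x)"
      by (auto simp: algebra_simps)
    then have "I (\<lambda>x. x * r x) = I (\<lambda>x. (x - x0) * r x + x0 * r x)" by simp
    also have "\<dots> = I (\<lambda>x. (x - x0) * r x) + I (\<lambda>x. x0 * r x)"
      by (rule I_add) (intro continuous_intros rc)+
    finally show ?thesis unfolding I_mult Ir Irx0 by simp
  qed
  \<comment> \<open>Continuity of \<open>r\<close> is known on \<open>{0..l}\<close> only; clamping
    its argument gives a continuous function on the line with the same values on the edge.\<close>
  define \<psi> where "\<psi> = (\<lambda>x. \<eta> x * r (max 0 (min l x)))"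
  have \<psi>c: "continuous_on UNIV \<psi>"
    unfolding \<psi>_def
    by (intro continuous_intros \<eta>c continuous_on_compose2[OF rc]) (use l_pos in auto)
  have \<psi>eq: "\<psi> x = \<eta> x * r x" if "x \<in> {0..l}" for x
    using that by (simp add: \<psi>_def)
  have wr: "I (\<lambda>x. w x * r x) = 0"
  proof -
    have "integral {0..l} (\<lambda>x. w x * \<psi> x) = 0"
    proof (rule integral_w_orthogonal[OF \<psi>c, of d "l - d"])
      have "integral {0..l} \<psi> = I r"
        unfolding I_def by (rule Henstock_Kurzweil_Integration.integral_cong) (rule \<psi>eq)
      then show "integral {0..l} \<psi> = 0" using Ir by simp
      have "integral {0..l} (\<lambda>x. x * \<psi> x) = I (\<lambda>x. x * r x)"
        unfolding I_def by (rule Henstock_Kurzweil_Integration.integral_cong) (simp add: \<psi>eq)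
      then show "integral {0..l} (\<lambda>x. x * \<psi> x) = 0" using Irx by simp
    qed (use d \<eta>out in \<open>auto simp: \<psi>_def\<close>)
    moreover have "integral {0..l} (\<lambda>x. w x * \<psi> x) = I (\<lambda>x. w x * r x)"
      unfolding I_def by (rule Henstock_Kurzweil_Integration.integral_cong) (simp add: \<psi>eq)
    ultimately show ?thesis by simp
  qed
  \<comment> \<open>One factor \<open>r\<close> is expanded as \<open>w - a - b (x - x0)\<close>;
    each term times \<open>r\<close> has weighted integral 0.\<close>
  have "I (\<lambda>x. (r x)\<^sup>2) = 0"
  proof -
    have "(\<lambda>x. (r x)\<^sup>2) = (\<lambda>x. w x * r x + ((- a) * r x + (- b) * ((x - x0) * r x)))"
      by (auto simp: r_def algebra_simps power2_eq_square)
    then have "I (\<lambda>x. (r x)\<^sup>2) = I (\<lambda>x. w x * r x + ((- a) * r x + (- b) * ((x - x0) * r x)))" by simp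
    also have "\<dots> = I (\<lambda>x. w x * r x) + I (\<lambda>x. (- a) * r x + (- b) * ((x - x0) * r x))"
      by (rule I_add) (intro continuous_intros rc w_cont)+
    also have "I (\<lambda>x. (- a) * r x + (- b) * ((x - x0) * r x)) = I (\<lambda>x. (- a) * r x) + I (\<lambda>x. (- b) * ((x - x0) * r x))"
      by (rule I_add) (intro continuous_intros rc)+
    finally show ?thesis unfolding I_mult Ir Irx0 wr by simp
  qed
  then have "r x = 0" if "d < x" "x < l - d" for x
    using vanish[OF rc _ that] by (simp add: I_def)
  then show thesis
    by (intro that[of "a - b * x0" b]) (force simp: r_def algebra_simps)
qed

text \<open>Away from the ends \<open>u\<close> is affine minus \<open>lam V\<close>, and
  \<open>V'' = u\<close> holds classically. The affine coefficients may depend on \<open>d\<close>,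
  but derivatives at \<open>x\<close> are local, so nothing has to be glued.\<close>

lemma classical_derivatives:
  assumes "0 < x" "x < l"
  shows "(u has_real_derivative deriv u x) (at x)"
    and "(deriv u has_real_derivative - lam * u x) (at x)"
proof -
  define d where "d = min x (l - x) / 2"
  have d: "0 < d" "d < l / 2" "d < x" "x < l - d"
    using assms by (auto simp: d_def min_def field_simps)
  obtain \<alpha> \<beta> where w: "\<And>x. d < x \<Longrightarrow> x < l - d \<Longrightarrow> w x = \<alpha> + \<beta> * x"
    using w_affine[OF d(1,2)] by blast
  have at: "at y within {0..l} = at y" if "y \<in> {d<..<l-d}" for y
    using that d by (intro at_within_interior) auto
  have V': "(V has_real_derivative V1 y) (at y)" "(V1 has_real_derivative u y) (at y)"
    if "y \<in> {d<..<l-d}" for y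
    using V_deriv[of y] V1_deriv[of y] at[OF that] that d by auto
  have ueq: "u y = \<alpha> + \<beta> * y - lam * V y" if "y \<in> {d<..<l-d}" for y
    using w[of y] that by (simp add: w_def)
  have u': "(u has_real_derivative \<beta> - lam * V1 y) (at y)" if y: "y \<in> {d<..<l-d}" for y
  proof -
    have "((\<lambda>y. \<alpha> + \<beta> * y - lam * V y) has_real_derivative \<beta> - lam * V1 y) (at y)"
      by (auto intro!: derivative_eq_intros V'[OF y])
    then show ?thesis
      by (rule has_field_derivative_transform_within_open[where S = "{d<..<l-d}"])
        (use y ueq in auto)
  qed
  have x: "x \<in> {d<..<l-d}" using d by auto
  show "(u has_real_derivative deriv u x) (at x)"
    using u'[OF x] DERIV_imp_deriv by fastforce
  have "((\<lambda>y. \<beta> - lam * V1 y) has_real_derivative - lam * u x) (at x)"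
    by (auto intro!: derivative_eq_intros V'[OF x])
  then show "(deriv u has_real_derivative - lam * u x) (at x)"
    by (rule has_field_derivative_transform_within_open[where S = "{d<..<l-d}"])
      (use x DERIV_imp_deriv[OF u'] in auto)
qed

section \<open>Energy conservation and the sup bound for large eigenvalues\<close>

lemma energy_constant:
  assumes "0 < x" "x < l"
  shows "(deriv u x)\<^sup>2 + lam * (u x)\<^sup>2 = (deriv u (l/2))\<^sup>2 + lam * (u (l/2))\<^sup>2"
proof (rule has_field_derivative_zero_constant[of "{0<..<l}", THEN exE])
  show "convex {0<..<l}" by simp
  show "((\<lambda>x. (deriv u x)\<^sup>2 + lam * (u x)\<^sup>2) has_field_derivative 0) (at x within {0<..<l})"
    if "x \<in> {0<..<l}" for x
  proof -
    have y: "0 < x" "x < l" using that by auto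
    have "((\<lambda>x. (deriv u x)\<^sup>2 + lam * (u x)\<^sup>2) has_field_derivative
        2 * deriv u x * (- lam * u x) + lam * (2 * u x * deriv u x)) (at x)"
      using DERIV_add[OF DERIV_power[OF classical_derivatives(2)[OF y], of 2]
          DERIV_cmult[OF DERIV_power[OF classical_derivatives(1)[OF y], of 2], of lam]]
      by (simp add: mult_ac)
    then show ?thesis
      by (rule has_field_derivative_at_within[THEN DERIV_cong]) simp
  qed
  fix c assume "\<forall>x\<in>{0<..<l}. (deriv u x)\<^sup>2 + lam * (u x)\<^sup>2 = c"
  then show ?thesis using assms by auto
qed

text \<open>With \<open>s = sqrt lam\<close>, integration over the middle half gives
  \<open>K l / 2 \<le> 2 lam + K / s\<close>. As \<open>s \<ge> 8 / l\<close>, the last term is at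
  most \<open>K l / 8\<close> and is absorbed, so \<open>K l \<le> 16 lam / 3\<close>, rounded up to
  \<open>8 lam\<close>. The norm is bounded by 1 and not fixed, since one edge may carry only part
  of the mass.\<close>

lemma sup_bound:
  assumes lam: "lam > 0" "8 / l \<le> sqrt lam" and norm: "(LINT x|lebesgue_on {0..l}. (u x)\<^sup>2) \<le> 1"
    and x: "x \<in> {0..l}"
  shows "(u x)\<^sup>2 \<le> 8 / l"
proof -
  define K where "K = (deriv u (l/2))\<^sup>2 + lam * (u (l/2))\<^sup>2"
  define s where "s = sqrt lam"
  have s: "s > 0" "lam = s\<^sup>2" "8 / l \<le> s" using lam by (auto simp: s_def)
  have K: "(deriv u y)\<^sup>2 + lam * (u y)\<^sup>2 = K" if "0 < y" "y < l" for y
    using energy_constant[OF that] by (simp add: K_def)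
  have Kge: "lam * (u y)\<^sup>2 \<le> K" if "0 < y" "y < l" for y
    using K[OF that] by (smt (verit) zero_le_power2)
  \<comment> \<open>Arithmetic-geometric mean inequality for \<open>\<bar>deriv u y\<bar>\<close>
    and \<open>s * \<bar>u y\<bar>\<close>, whose squares add up to \<open>K\<close>.\<close>
  have F: "\<bar>u y * deriv u y\<bar> \<le> K / (2 * s)" if "0 < y" "y < l" for y
  proof -
    have "0 \<le> (\<bar>deriv u y\<bar> - s * \<bar>u y\<bar>)\<^sup>2" by simp
    also have "\<dots> = K - 2 * s * \<bar>u y * deriv u y\<bar>"
      using K[OF that] by (simp add: s power2_diff power_mult_distrib abs_mult)
    finally show ?thesis using s by (simp add: field_simps)
  qed
  \<comment> \<open>The middle half avoids the ends, where only continuity of \<open>u\<close> has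
    been established.\<close>
  have sub: "{l/4..3*l/4} \<subseteq> {0..l}" using l_pos by auto
  have "((\<lambda>y. K - 2 * lam * (u y)\<^sup>2) has_integral
      u (3*l/4) * deriv u (3*l/4) - u (l/4) * deriv u (l/4)) {l/4..3*l/4}"
  proof (rule integral_FTC_real)
    fix y assume "y \<in> {l/4..3*l/4}"
    then have y: "0 < y" "y < l" using l_pos by auto
    have "((\<lambda>y. u y * deriv u y) has_real_derivative deriv u y * deriv u y + - lam * u y * u y) (at y)"
      by (rule DERIV_mult[OF classical_derivatives[OF y]])
    also have "deriv u y * deriv u y + - lam * u y * u y = K - 2 * lam * (u y)\<^sup>2"
      unfolding K[OF y, symmetric] by (simp add: power2_eq_square)
    finally show "((\<lambda>y. u y * deriv u y) has_real_derivative K - 2 * lam * (u y)\<^sup>2) (at y within {l/4..3*l/4})"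
      by (rule has_field_derivative_at_within)
  qed (use l_pos in auto)
  then have "integral {l/4..3*l/4} (\<lambda>y. K - 2 * lam * (u y)\<^sup>2) =
      u (3*l/4) * deriv u (3*l/4) - u (l/4) * deriv u (l/4)"
    by (rule integral_unique)
  moreover have "integral {l/4..3*l/4} (\<lambda>y. K - 2 * lam * (u y)\<^sup>2) =
      integral {l/4..3*l/4} (\<lambda>y. K) - integral {l/4..3*l/4} (\<lambda>y. 2 * lam * (u y)\<^sup>2)"
    by (rule Henstock_Kurzweil_Integration.integral_diff)
       (auto intro!: integrable_continuous_real continuous_intros continuous_on_subset[OF cont sub])
  moreover have "integral {l/4..3*l/4} (\<lambda>y. 2 * lam * (u y)\<^sup>2) = 2 * lam * integral {l/4..3*l/4} (\<lambda>y. (u y)\<^sup>2)"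
    by simp
  moreover have "integral {l/4..3*l/4} (\<lambda>y. (u y)\<^sup>2) \<le> 1"
  proof -
    have "integral {l/4..3*l/4} (\<lambda>y. (u y)\<^sup>2) \<le> integral {0..l} (\<lambda>y. (u y)\<^sup>2)"
      by (rule integral_subset_le[OF sub])
         (auto intro!: integrable_continuous_real continuous_intros cont continuous_on_subset[OF cont sub])
    also have "\<dots> \<le> 1" using norm by (simp add: LINT_interval_eq_integral cont continuous_on_power)
    finally show ?thesis .
  qed
  then have "2 * lam * integral {l/4..3*l/4} (\<lambda>y. (u y)\<^sup>2) \<le> 2 * lam"
    using lam mult_left_mono[of _ 1 "2 * lam"] by fastforce
  moreover have "integral {l/4..3*l/4} (\<lambda>y. K) = K * (l/2)"
    using l_pos by simp
  ultimately have "K * (l/2) \<le> 2 * lam + u (3*l/4) * deriv u (3*l/4) - u (l/4) * deriv u (l/4)"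
    by linarith
  also have "\<dots> \<le> 2 * lam + K / s"
    using F[of "3*l/4"] F[of "l/4"] l_pos by (simp add: field_simps)
  finally have "K * (l/2) \<le> 2 * lam + K / s" .
  moreover have "K / s \<le> K * (l / 8)"
  proof -
    have "1 / s \<le> l / 8" using s l_pos by (simp add: field_simps)
    moreover have "K \<ge> 0" using lam by (simp add: K_def)
    ultimately show ?thesis using mult_left_mono by fastforce
  qed
  moreover have "K * l \<ge> 0" using lam l_pos by (simp add: K_def)
  moreover have "K * (l/2) = K * l / 2" "K * (l/8) = K * l / 8" by simp_all
  ultimately have "K * l \<le> lam * 8" using lam by linarith
  then have KL: "K \<le> lam * (8 / l)" using l_pos by (simp add: field_simps)
  \<comment> \<open>The energy argument reaches interior points; the ends follow by
    continuity.\<close>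
  have "(u y)\<^sup>2 \<le> 8 / l" if "y \<in> {0<..<l}" for y
  proof -
    have "lam * (u y)\<^sup>2 \<le> lam * (8 / l)" using Kge[of y] KL that by simp
    then show ?thesis using lam by (simp only: mult_le_cancel_left_pos)
  qed
  moreover have "closure {0<..<l} = {0..l}" using l_pos by simp
  ultimately show ?thesis
    using x by (intro continuous_le_on_closure[of "{0<..<l}" "\<lambda>y. (u y)\<^sup>2" x "8/l"])
      (auto intro!: continuous_intros cont)
qed

end

section \<open>Uniformity over eigenfunctions and edges\<close>

theorem theorem9:
  fixes G :: "('v, 'e) pre_digraph" and len :: "'e \<Rightarrow> real"
    and C :: "'e boundary_condition set"
    and \<rho> :: real and \<phi> :: "nat \<Rightarrow> 'e edgefun" and ev :: "nat \<Rightarrow> real"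
  assumes "compact_metric_graph G len"
    and "self_adjoint G len (laplacian_domain G len C) (laplacian len)"
    and "compact_resolvent G len (laplacian_domain G len C) (laplacian len)"
    and "\<rho> > 0"
    and "positive_op G len (laplacian_domain G len C) (shifted \<rho> (laplacian len))"
    and "\<And>i. \<phi> i \<in> laplacian_domain G len C"
    and "orthonormal_basis G len \<phi>"
    and "\<And>i. ae_eq G len (laplacian len (\<phi> i)) (\<lambda>e x. - ev i * \<phi> i e x)"
    and "filterlim ev at_top sequentially"
  shows "(SUP i. SUP e\<in>arcs G. SUP x\<in>{0..len e}. ereal \<bar>\<phi> i e x\<bar>) < \<infinity>"
proof -
  interpret compact_metric_graph G len by fact
  have edge: "edge_eigenfunction (len e) (ev i) (\<phi> i e)" if "e \<in> arcs G" for i e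
    using that assms(6)[of i] assms(8)[of i] len_pos
    by unfold_locales (auto simp: laplacian_domain_def ae_eq_def laplacian_def)
  \<comment> \<open>The edge integrals are nonnegative and add up to 1.\<close>
  have norm: "(LINT x|lebesgue_on {0..len e}. (\<phi> i e x)\<^sup>2) \<le> 1" if "e \<in> arcs G" for i e
  proof -
    have "(LINT x|lebesgue_on {0..len e}. (\<phi> i e x)\<^sup>2)
        \<le> (\<Sum>e\<in>arcs G. LINT x|lebesgue_on {0..len e}. (\<phi> i e x)\<^sup>2)"
      by (rule member_le_sum) (use that in auto)
    also have "\<dots> = L2_inner G len (\<phi> i) (\<phi> i)"
      by (simp add: L2_inner_def power2_eq_square)
    also have "\<dots> = 1" using assms(7) by (simp add: orthonormal_basis_def)
    finally show ?thesis .
  qed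
  have "\<exists>B. \<forall>i. \<forall>x\<in>{0..len e}. \<bar>\<phi> i e x\<bar> \<le> B" if e: "e \<in> arcs G" for e
  proof -
    \<comment> \<open>The 1 makes the eigenvalue positive; the square gives
      \<open>8 / len e \<le> sqrt (ev i)\<close>.\<close>
    have "eventually (\<lambda>i. max 1 ((8 / len e)\<^sup>2) \<le> ev i) sequentially"
      using assms(9) unfolding filterlim_at_top by blast
    then obtain N where N: "\<And>i. i \<ge> N \<Longrightarrow> max 1 ((8 / len e)\<^sup>2) \<le> ev i"
      by (auto simp: eventually_sequentially)
    have large: "\<bar>\<phi> i e x\<bar> \<le> sqrt (8 / len e)" if "i \<ge> N" "x \<in> {0..len e}" for i x
    proof (rule real_le_rsqrt)
      have "8 / len e \<le> sqrt (ev i)" by (rule real_le_rsqrt) (use N[OF that(1)] in auto)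
      then show "\<bar>\<phi> i e x\<bar>\<^sup>2 \<le> 8 / len e"
        using edge_eigenfunction.sup_bound[OF edge[OF e], of i x] N[OF that(1)] norm[OF e] that by auto
    qed
    \<comment> \<open>The finitely many remaining indices, among them any with nonpositive
      eigenvalue, are handled by compactness of the closed edge.\<close>
    have "bounded (\<Union>i<N. \<phi> i e ` {0..len e})"
      using e assms(6)
      by (intro bounded_UN ballI compact_imp_bounded compact_continuous_image)
         (auto simp: laplacian_domain_def)
    then obtain M where M: "\<And>i x. i < N \<Longrightarrow> x \<in> {0..len e} \<Longrightarrow> \<bar>\<phi> i e x\<bar> \<le> M"
      unfolding bounded_iff real_norm_def by blast
    have "\<bar>\<phi> i e x\<bar> \<le> max M (sqrt (8 / len e))" if "x \<in> {0..len e}" for i x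
      using large[of i x] M[of i x] that by (cases "i < N") (auto simp: le_max_iff_disj)
    then show ?thesis by blast
  qed
  then obtain B where B: "\<And>e i x. e \<in> arcs G \<Longrightarrow> x \<in> {0..len e} \<Longrightarrow> \<bar>\<phi> i e x\<bar> \<le> B e"
    by metis
  \<comment> \<open>There are finitely many edges, so the sum of their bounds dominates each
    one.\<close>
  have "\<bar>\<phi> i e x\<bar> \<le> (\<Sum>e\<in>arcs G. \<bar>B e\<bar>)" if "e \<in> arcs G" "x \<in> {0..len e}" for e i x
    using B[OF that, of i] member_le_sum[of e "arcs G" "\<lambda>e. \<bar>B e\<bar>"] that by fastforce
  then have "(SUP i. SUP e\<in>arcs G. SUP x\<in>{0..len e}. ereal \<bar>\<phi> i e x\<bar>) \<le> ereal (\<Sum>e\<in>arcs G. \<bar>B e\<bar>)"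
    by (intro SUP_least) simp
  also have "\<dots> < \<infinity>" by simp
  finally show ?thesis .
qed

end
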